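(* Consider the coordinate transformation $\boldsymbol x=\boldsymbol x(r,\theta,\omega)$, $$\boldsymbol x=\boldsymbol r_c(\omega)+rR(\theta,\omega)\cos\theta\,\boldsymbol e_2(\omega)+rR(\theta,\omega)\sin\theta\,\boldsymbol e_3(\omega),\qquad r\in(0,1),\ \theta\in[0,2\pi),\ \omega\in I_\omega .$$ Its Jacobian is $$\mathbb J=rR^2(\theta,\omega)\,\|\boldsymbol r_c'\|\,\bigl(1-r\kappa R(\theta,\omega)\cos\theta\bigr)=rR^2(\theta,\omega)\,\rho(r,\theta,\omega),\qquad \rho(r,\theta,\omega):=\|\boldsymbol r_c'\|\bigl(1-r\kappa R(\theta,\omega)\cos\theta\bigr).$$ Where $\mathbb J>0$, the contravariant metric tensor $\boldsymbol G^{-1}=(\boldsymbol G^{-1})^\top=(g^{ij})_{i,j=1,2,3}$ is given by $$g^{11}=\frac{\tilde R}{R^4}+\frac{r^2\hat R^2}{\rho^2R^2},\qquad g^{22}=\frac1{r^2R^2}+\frac{\tau^2\|\boldsymbol r_c'\|^2}{\rho^2},\qquad g^{33}=\frac1{\rho^2},$$ $$g^{12}=-\frac{\partial_\theta R}{rR^3}+\frac{r\tau\|\boldsymbol r_c'\|\hat R}{\rho^2R},\qquad g^{13}=-\frac{r\hat R}{\rho^2R},\qquad g^{23}=-\frac{\tau\|\boldsymbol r_c'\|}{\rho^2},$$ where $\tilde R=R^2+(\partial_\theta R)^2$ and $\hat R=\partial_\omega R-\tau\|\boldsymbol r_c'\|\,\partial_\theta R$. Furthermore, $\mathbb J>0$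 whenever $\theta\in[\pi/2,3\pi/2]$, and for $\theta\in[0,\pi/2)\cup(3\pi/2,2\pi)$ one has $\mathbb J>0$ provided that $$\max_{\omega'\in\bar I_\omega}R(\theta,\omega')<\kappa(\omega)^{-1}\sec\theta\quad\text{for all }\omega\in \bar I_\omega .$$
   Context: $\boldsymbol r_c:\bar I_\omega\to\mathbb R^3$ is a sufficiently smooth parametrized curve on an interval with $\boldsymbol r_c'(\omega)\ne0$ and nonzero curvature everywhere. Its moving orthonormal (TNB) frame is $$\boldsymbol e_1=\frac{\boldsymbol r_c'}{\|\boldsymbol r_c'\|},\qquad \boldsymbol e_3=\frac{\boldsymbol r_c'\times\boldsymbol r_c''}{\|\boldsymbol r_c'\times\boldsymbol r_c''\|},\qquad \boldsymbol e_2=\boldsymbol e_3\times\boldsymbol e_1,$$ and its curvature and torsion (functions of $\omega$) are $$\kappa=\frac{\|\boldsymbol r_c'\times\boldsymbol r_c''\|}{\|\boldsymbol r_c'\|^3},\qquad \tau=\frac{(\boldsymbol r_c'\times\boldsymbol r_c'')\cdot\boldsymbol r_c'''}{\|\boldsymbol r_c'\times\boldsymbol r_c''\|^2}.$$ The cross-sectional function $R(\theta,\omega)>0$ is smooth and satisfies $R(\theta+2\pi,\omega)=R(\theta,\omega)$. With $\boldsymbol\xi=(\xi_1,\xi_2,\xi_3)=(r,\theta,\omega)$ and $\boldsymbol x=(x,y,z)^\top$, the Jacobi matrix is $\boldsymbol J=\partial(x,y,z)/\partial(r,\theta,\omega)$, the Jacobian is $\mathbb J=\det\boldsymbol J$,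 the covariant metric tensor is $\boldsymbol G=\boldsymbol J^\top\boldsymbol J$, and the contravariant metric tensor is its inverse $\boldsymbol G^{-1}=(g^{ij})$. *)

theory Defs
  imports "HOL-Analysis.Analysis"
begin

unbundle cross3_syntax

text \<open>
  Throughout, \<open>S\<close> is the closure of the parameter interval. The curve is only meaningful
  on \<open>S\<close>, so derivatives in the curve parameter are taken within \<open>S\<close>: they are the ordinary
  derivatives in the interior and one-sided at endpoints that belong to \<open>S\<close>.
\<close>

definition deriv_on :: "real set \<Rightarrow> (real \<Rightarrow> 'a::real_normed_vector) \<Rightarrow> real \<Rightarrow> 'a" where
  "deriv_on S f t = vector_derivative f (at t within S)"

definition C_k_on :: "nat \<Rightarrow> real set \<Rightarrow> (real \<Rightarrow> 'a::real_normed_vector) \<Rightarrow> bool" where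
  "C_k_on k S f \<longleftrightarrow>
     (\<forall>j<k. \<forall>t\<in>S. (deriv_on S ^^ j) f differentiable (at t within S)) \<and>
     continuous_on S ((deriv_on S ^^ k) f)"

context
  fixes S :: "real set" and rc :: "real \<Rightarrow> real^3"
begin

definition speed :: "real \<Rightarrow> real" where
  "speed \<omega> = norm (deriv_on S rc \<omega>)"

definition binormal_raw :: "real \<Rightarrow> real^3" where
  "binormal_raw \<omega> = deriv_on S rc \<omega> \<times> deriv_on S (deriv_on S rc) \<omega>"

definition frame1 :: "real \<Rightarrow> real^3" where
  "frame1 \<omega> = deriv_on S rc \<omega> /\<^sub>R norm (deriv_on S rc \<omega>)"

definition frame3 :: "real \<Rightarrow> real^3" where
  "frame3 \<omega> = binormal_raw \<omega> /\<^sub>R norm (binormal_raw \<omega>)"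

definition frame2 :: "real \<Rightarrow> real^3" where
  "frame2 \<omega> = frame3 \<omega> \<times> frame1 \<omega>"

definition curvature :: "real \<Rightarrow> real" where
  "curvature \<omega> = norm (binormal_raw \<omega>) / norm (deriv_on S rc \<omega>) ^ 3"

definition torsion :: "real \<Rightarrow> real" where
  "torsion \<omega> =
     (binormal_raw \<omega> \<bullet> deriv_on S (deriv_on S (deriv_on S rc)) \<omega>) / norm (binormal_raw \<omega>) ^ 2"

end

definition d_theta :: "(real \<Rightarrow> real \<Rightarrow> real) \<Rightarrow> real \<Rightarrow> real \<Rightarrow> real" where
  "d_theta R \<theta> \<omega> = deriv (\<lambda>t. R t \<omega>) \<theta>"

definition d_omega :: "real set \<Rightarrow> (real \<Rightarrow> real \<Rightarrow> real) \<Rightarrow> real \<Rightarrow> real \<Rightarrow> real" where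
  "d_omega S R \<theta> \<omega> = deriv_on S (\<lambda>w. R \<theta> w) \<omega>"

definition C1_section :: "real set \<Rightarrow> (real \<Rightarrow> real \<Rightarrow> real) \<Rightarrow> bool" where
  "C1_section S R \<longleftrightarrow>
     (\<forall>p \<in> Sigma UNIV (\<lambda>_. S). (\<lambda>(\<theta>, \<omega>). R \<theta> \<omega>) differentiable (at p within Sigma UNIV (\<lambda>_. S))) \<and>
     continuous_on (Sigma UNIV (\<lambda>_. S)) (\<lambda>(\<theta>, \<omega>). d_theta R \<theta> \<omega>) \<and>
     continuous_on (Sigma UNIV (\<lambda>_. S)) (\<lambda>(\<theta>, \<omega>). d_omega S R \<theta> \<omega>)"

definition R_tilde :: "(real \<Rightarrow> real \<Rightarrow> real) \<Rightarrow> real \<Rightarrow> real \<Rightarrow> real" where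
  "R_tilde R \<theta> \<omega> = (R \<theta> \<omega>)^2 + (d_theta R \<theta> \<omega>)^2"

definition R_hat :: "real set \<Rightarrow> (real \<Rightarrow> real^3) \<Rightarrow> (real \<Rightarrow> real \<Rightarrow> real) \<Rightarrow> real \<Rightarrow> real \<Rightarrow> real" where
  "R_hat S rc R \<theta> \<omega> = d_omega S R \<theta> \<omega> - torsion S rc \<omega> * speed S rc \<omega> * d_theta R \<theta> \<omega>"

definition rho ::
  "real set \<Rightarrow> (real \<Rightarrow> real^3) \<Rightarrow> (real \<Rightarrow> real \<Rightarrow> real) \<Rightarrow> real \<Rightarrow> real \<Rightarrow> real \<Rightarrow> real" where
  "rho S rc R r \<theta> \<omega> = speed S rc \<omega> * (1 - r * curvature S rc \<omega> * R \<theta> \<omega> * cos \<theta>)"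

text \<open>The coordinate vector \<open>\<xi>\<close> has components \<open>(r, \<theta>, \<omega>)\<close>.\<close>

definition coord_map ::
  "real set \<Rightarrow> (real \<Rightarrow> real^3) \<Rightarrow> (real \<Rightarrow> real \<Rightarrow> real) \<Rightarrow> real^3 \<Rightarrow> real^3" where
  "coord_map S rc R \<xi> =
     (let r = \<xi>$1; \<theta> = \<xi>$2; \<omega> = \<xi>$3 in
        rc \<omega> + (r * R \<theta> \<omega> * cos \<theta>) *\<^sub>R frame2 S rc \<omega>
             + (r * R \<theta> \<omega> * sin \<theta>) *\<^sub>R frame3 S rc \<omega>)"

text \<open>
  At points with \<open>\<omega>\<close> in the interior of \<open>S\<close>, the filters \<open>coord_filter S \<xi>\<close> and \<open>at \<xi>\<close>
  coincide, so the matrix below is the usual Jacobi matrix there.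
\<close>

abbreviation coord_filter :: "real set \<Rightarrow> real^3 \<Rightarrow> (real^3) filter" where
  "coord_filter S \<xi> \<equiv> at \<xi> within {\<eta>. \<eta>$3 \<in> S}"

definition jacobi_matrix ::
  "real set \<Rightarrow> (real \<Rightarrow> real^3) \<Rightarrow> (real \<Rightarrow> real \<Rightarrow> real) \<Rightarrow> real^3 \<Rightarrow> real^3^3" where
  "jacobi_matrix S rc R \<xi> = jacobian (coord_map S rc R) (coord_filter S \<xi>)"

definition covariant_metric ::
  "real set \<Rightarrow> (real \<Rightarrow> real^3) \<Rightarrow> (real \<Rightarrow> real \<Rightarrow> real) \<Rightarrow> real^3 \<Rightarrow> real^3^3" where
  "covariant_metric S rc R \<xi> = transpose (jacobi_matrix S rc R \<xi>) ** jacobi_matrix S rc R \<xi>"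

definition contravariant_metric ::
  "real set \<Rightarrow> (real \<Rightarrow> real^3) \<Rightarrow> (real \<Rightarrow> real \<Rightarrow> real) \<Rightarrow> real^3 \<Rightarrow> real^3^3" where
  "contravariant_metric S rc R \<xi> = matrix_inv (covariant_metric S rc R \<xi>)"

end

theory Submission
  imports Defs
begin

text \<open>
  Write \<open>n = cos \<theta> e\<^sub>2 + sin \<theta> e\<^sub>3\<close> and \<open>m = cos \<theta> e\<^sub>3 - sin \<theta> e\<^sub>2\<close>. By the Frenet equations the columns
  of the Jacobi matrix, expressed in the positively oriented orthonormal basis \<open>(n, m, e\<^sub>1)\<close>, form the
  upper triangular matrix \<open>U\<close> with rows \<open>(R, r R\<^sub>\<theta>, r R\<^sub>\<omega>)\<close>, \<open>(0, r R, r R \<tau> v)\<close>, \<open>(0, 0, \<rho>)\<close>, where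
  \<open>v\<close> is the speed of the curve. Hence the Jacobian is the product of the diagonal entries, and the
  contravariant metric is \<open>W W\<^sup>T\<close> with \<open>W = U\<^sup>-\<^sup>1\<close>, which can be written down explicitly.
\<close>

section \<open>Inverse matrices; derivatives of cross products and normalized vectors\<close>

text \<open>\<open>matrix_inv\<close> is a Hilbert choice, so its value is pinned down only through
  its specification. A right inverse of a square matrix is two-sided, which shows that the choice is
  not vacuous.\<close>

lemma matrix_inv_unique:
  fixes A B :: "real^'n^'n"
  assumes "A ** B = mat 1"
  shows "matrix_inv A = B"
proof -
  have "B ** A = mat 1"
    using assms matrix_left_right_inverse by blast
  then have "A ** matrix_inv A = mat 1"
    unfolding matrix_inv_def using assms someI[of "\<lambda>C. A ** C = mat 1 \<and> C ** A = mat 1" B] by blast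
  then show ?thesis
    by (metis \<open>B ** A = mat 1\<close> matrix_mul_assoc matrix_mul_lid matrix_mul_rid)
qed

lemmas has_vector_derivative_cross3 =
  bounded_bilinear.has_vector_derivative[OF bilinear_cross[unfolded bilinear_conv_bounded_bilinear]]

text \<open>Product rule for \<open>inverse (norm f)\<close> and \<open>f\<close>. The result is the
  component of \<open>f'\<close> orthogonal to \<open>f t\<close>, divided by
  \<open>norm (f t)\<close>; both direct Frenet computations below rest on this form.\<close>

lemma has_vector_derivative_normalize:
  fixes f :: "real \<Rightarrow> 'a::real_inner"
  assumes f: "(f has_vector_derivative f') (at t within S)" and nz: "f t \<noteq> 0"
  shows "((\<lambda>s. f s /\<^sub>R norm (f s)) has_vector_derivative
    f' /\<^sub>R norm (f t) - ((f t \<bullet> f') / norm (f t) ^ 3) *\<^sub>R f t) (at t within S)"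
proof -
  have "((\<lambda>s. norm (f s)) has_derivative (\<lambda>h. (h *\<^sub>R f') \<bullet> sgn (f t))) (at t within S)"
    using has_derivative_compose[OF f[unfolded has_vector_derivative_def] has_derivative_norm[OF nz]]
    by simp
  then have "((\<lambda>s. norm (f s)) has_field_derivative f' \<bullet> sgn (f t)) (at t within S)"
    unfolding has_field_derivative_def by (rule has_derivative_eq_rhs) (auto simp: fun_eq_iff)
  then have "((\<lambda>s. inverse (norm (f s))) has_field_derivative
      - (inverse (norm (f t)) * (f' \<bullet> sgn (f t)) * inverse (norm (f t)))) (at t within S)"
    using nz by (intro DERIV_inverse') auto
  from has_vector_derivative_scaleR[OF this f] show ?thesis
    by (rule has_vector_derivative_eq_rhs)
      (simp add: sgn_div_norm inner_commute field_simps power3_eq_cube)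
qed

section \<open>The moving frame and the Frenet equations at a point\<close>

context
  fixes S :: "real set" and rc :: "real \<Rightarrow> real^3" and t :: real
  assumes smooth: "C_k_on 3 S rc" and t: "t \<in> S"
    and regular: "deriv_on S rc t \<noteq> 0" and curved: "curvature S rc t \<noteq> 0"
begin

private abbreviation (input) "v \<equiv> speed S rc t"
private abbreviation (input) "\<kappa> \<equiv> curvature S rc t"
private abbreviation (input) "\<tau> \<equiv> torsion S rc t"
private abbreviation (input) "e1 \<equiv> frame1 S rc"
private abbreviation (input) "e2 \<equiv> frame2 S rc"
private abbreviation (input) "e3 \<equiv> frame3 S rc"
private abbreviation (input) "a \<equiv> deriv_on S rc"
private abbreviation (input) "b \<equiv> deriv_on S (deriv_on S rc)"
private abbreviation (input) "c \<equiv> deriv_on S (deriv_on S (deriv_on S rc))"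
private abbreviation (input) "\<beta> \<equiv> binormal_raw S rc"

lemma speed_pos: "v > 0"
  using regular by (simp add: speed_def)

lemma binormal_raw_nz: "\<beta> t \<noteq> 0"
  using curved by (auto simp: curvature_def)

lemma curvature_pos: "\<kappa> > 0"
  using regular binormal_raw_nz by (simp add: curvature_def)

lemma curve_derivs:
  "(rc has_vector_derivative a t) (at t within S)"
  "(a has_vector_derivative b t) (at t within S)"
  "(b has_vector_derivative c t) (at t within S)"
proof -
  have d: "\<And>j. j < 3 \<Longrightarrow> ((deriv_on S ^^ j) rc has_vector_derivative (deriv_on S ^^ Suc j) rc t) (at t within S)"
    using smooth t by (auto simp: C_k_on_def deriv_on_def[of S "(deriv_on S ^^ _) rc" t] vector_derivative_works)
  show "(rc has_vector_derivative a t) (at t within S)"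
    using d[of 0] by simp
  show "(a has_vector_derivative b t) (at t within S)"
    using d[of 1] by simp
  show "(b has_vector_derivative c t) (at t within S)"
    using d[of 2] by (simp add: numeral_2_eq_2)
qed

lemma frame_orthonormal:
  "e1 t \<bullet> e1 t = 1" "e3 t \<bullet> e3 t = 1" "e1 t \<bullet> e3 t = 0"
  "e2 t \<bullet> e2 t = 1" "e1 t \<bullet> e2 t = 0" "e2 t \<bullet> e3 t = 0"
  "e2 t \<times> e3 t = e1 t" "e1 t \<times> e2 t = e3 t"
proof -
  show 1: "e1 t \<bullet> e1 t = 1"
    using regular by (simp add: frame1_def power2_norm_eq_inner[symmetric] field_simps power2_eq_square)
  show 3: "e3 t \<bullet> e3 t = 1"
    using binormal_raw_nz by (simp add: frame3_def power2_norm_eq_inner[symmetric] field_simps power2_eq_square)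
  show 13: "e1 t \<bullet> e3 t = 0"
    by (simp add: frame1_def frame3_def binormal_raw_def dot_cross_self)
  \<comment> \<open>Since \<open>e2\<close> is \<open>e3\<close> x \<open>e1\<close>, both are
    double cross products; their expansion collapses by orthonormality of \<open>e1\<close> and
    \<open>e3\<close>.\<close>
  show 31: "e2 t \<times> e3 t = e1 t" "e1 t \<times> e2 t = e3 t"
    using 1 3 13 by (simp_all add: frame2_def cross_skew[of "e3 t \<times> e1 t"] Lagrange inner_commute)
  show "e2 t \<bullet> e2 t = 1"
    using norm_cross_dot[of "e3 t" "e1 t"] 1 3 13
    by (simp add: frame2_def power2_norm_eq_inner power_mult_distrib inner_commute)
  show "e1 t \<bullet> e2 t = 0" "e2 t \<bullet> e3 t = 0"
    by (simp_all add: frame2_def dot_cross_self)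
qed

lemma curve_deriv_frame: "(rc has_vector_derivative v *\<^sub>R e1 t) (at t within S)"
  using curve_derivs(1) regular by (simp add: frame1_def speed_def)

text \<open>First Frenet equation. The component of \<open>b\<close> orthogonal to \<open>a\<close>
  is \<beta> x a divided by the squared norm of \<open>a\<close>, by the triple product expansion,
  and \<beta> x a is a positive multiple of \<open>e2\<close>.\<close>

lemma frame1_deriv: "(e1 has_vector_derivative (\<kappa> * v) *\<^sub>R e2 t) (at t within S)"
proof -
  let ?n = "norm (a t)" and ?N = "norm (\<beta> t)"
  have nz: "?n \<noteq> 0" "?N \<noteq> 0" using regular binormal_raw_nz by auto
  have eq: "\<beta> t \<times> a t = (?n ^ 2) *\<^sub>R b t - (a t \<bullet> b t) *\<^sub>R a t"
    by (simp add: binormal_raw_def cross_skew[of "a t \<times> b t"] Lagrange power2_norm_eq_inner)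
  have "(\<kappa> * v) *\<^sub>R e2 t = (1 / ?n ^ 3) *\<^sub>R (\<beta> t \<times> a t)"
    using nz by (simp add: curvature_def speed_def frame2_def frame1_def frame3_def
        cross_mult_left cross_mult_right field_simps power3_eq_cube)
  also have "\<dots> = b t /\<^sub>R ?n - ((a t \<bullet> b t) / ?n ^ 3) *\<^sub>R a t"
    unfolding eq using nz by (simp add: scaleR_diff_right field_simps power2_eq_square power3_eq_cube)
  finally have "(\<kappa> * v) *\<^sub>R e2 t = b t /\<^sub>R ?n - ((a t \<bullet> b t) / ?n ^ 3) *\<^sub>R a t" .
  then show ?thesis
    using has_vector_derivative_normalize[OF curve_derivs(2) regular]
    by (simp add: frame1_def[abs_def])
qed

text \<open>Third Frenet equation. In the derivative of a x b the term b x b vanishes, leaving a x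
  c. Its component orthogonal to \<beta> is written as a double cross product with \<beta>, which
  turns out to be a multiple of \<beta> x a, hence of \<open>e2\<close>.\<close>

lemma frame3_deriv: "(e3 has_vector_derivative (- \<tau> * v) *\<^sub>R e2 t) (at t within S)"
proof -
  let ?n = "norm (a t)" and ?N = "norm (\<beta> t)"
  have nz: "?n \<noteq> 0" "?N \<noteq> 0" using regular binormal_raw_nz by auto
  have d: "(\<beta> has_vector_derivative a t \<times> c t) (at t within S)"
    using has_vector_derivative_cross3[OF curve_derivs(2,3)] by (simp add: binormal_raw_def[abs_def])
  have "(?N ^ 2) *\<^sub>R (a t \<times> c t) - (\<beta> t \<bullet> (a t \<times> c t)) *\<^sub>R \<beta> t = \<beta> t \<times> ((a t \<times> c t) \<times> \<beta> t)"
    by (simp add: Lagrange power2_norm_eq_inner)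
  \<comment> \<open>The expansion is a combination of \<open>a\<close> and \<open>c\<close>. The
    coefficient of \<open>c\<close> vanishes because \<beta> is orthogonal to \<open>a\<close>; that
    of \<open>a\<close> gives the numerator of the torsion.\<close>
  also have "(a t \<times> c t) \<times> \<beta> t = - ((\<beta> t \<bullet> c t) *\<^sub>R a t)"
    using cross_triple[of "a t" "b t" "c t"] cross_triple[of "a t" "c t" "b t"] cross_skew[of "b t" "c t"]
    by (simp add: cross_skew[of "a t \<times> c t"] Lagrange binormal_raw_def dot_cross_self)
  finally have eq: "(?N ^ 2) *\<^sub>R (a t \<times> c t) - (\<beta> t \<bullet> (a t \<times> c t)) *\<^sub>R \<beta> t
      = - ((\<beta> t \<bullet> c t) *\<^sub>R (\<beta> t \<times> a t))"
    by (simp add: cross_mult_right)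
  have "(a t \<times> c t) /\<^sub>R ?N - ((\<beta> t \<bullet> (a t \<times> c t)) / ?N ^ 3) *\<^sub>R \<beta> t
      = (1 / ?N ^ 3) *\<^sub>R ((?N ^ 2) *\<^sub>R (a t \<times> c t) - (\<beta> t \<bullet> (a t \<times> c t)) *\<^sub>R \<beta> t)"
    using nz by (simp add: scaleR_diff_right field_simps power2_eq_square power3_eq_cube)
  also have "\<dots> = (- \<tau> * v) *\<^sub>R e2 t"
    unfolding eq using nz
    by (simp add: torsion_def speed_def frame2_def frame1_def frame3_def
        cross_mult_left cross_mult_right field_simps power2_eq_square power3_eq_cube)
  finally show ?thesis
    using has_vector_derivative_normalize[OF d binormal_raw_nz]
    by (simp add: frame3_def[abs_def])
qed

text \<open>Product rule for \<open>e2\<close> as the cross product of \<open>e3\<close> and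
  \<open>e1\<close>, with the two equations already proved.\<close>

lemma frame2_deriv: "(e2 has_vector_derivative (\<tau> * v) *\<^sub>R e3 t - (\<kappa> * v) *\<^sub>R e1 t) (at t within S)"
proof -
  have "e2 t \<times> e1 t = - e3 t" "e3 t \<times> e2 t = - e1 t"
    using frame_orthonormal(7,8) cross_skew by metis+
  moreover have "e2 = (\<lambda>s. e3 s \<times> e1 s)"
    by (simp add: frame2_def fun_eq_iff)
  ultimately show ?thesis
    using has_vector_derivative_cross3[OF frame3_deriv frame1_deriv]
    by (simp add: cross_mult_left cross_mult_right)
qed

section \<open>Derivative of the coordinate map in the moving frame\<close>

text \<open>The map is \<open>rc\<close> plus \<open>r * R\<close> times \<open>n\<close>. The
  \<theta>-derivative of \<open>n\<close> is \<open>m\<close>, and by the Frenet equations its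
  \<omega>-derivative is \<tau> v m - \<kappa> v cos \<theta> e1. The last term, together with the
  velocity v e1 of \<open>rc\<close>, produces \<open>rho\<close>. Here \<open>p\<close> and
  \<open>d\<close> stand for the partial derivatives of \<open>R\<close>.\<close>

lemma coord_map_has_derivative:
  fixes R :: "real \<Rightarrow> real \<Rightarrow> real" and r \<theta> p d :: real
  defines "q \<equiv> R \<theta> t" and "\<xi> \<equiv> vector [r, \<theta>, t] :: real^3"
    and "n \<equiv> cos \<theta> *\<^sub>R e2 t + sin \<theta> *\<^sub>R e3 t" and "m \<equiv> cos \<theta> *\<^sub>R e3 t - sin \<theta> *\<^sub>R e2 t"
  assumes R: "((\<lambda>(s, w). R s w) has_derivative (\<lambda>(h, k). h * p + k * d))
    (at (\<theta>, t) within Sigma UNIV (\<lambda>_. S))"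
  shows "(coord_map S rc R has_derivative (\<lambda>h. (h$1 * q + h$2 * (r * p) + h$3 * (r * d)) *\<^sub>R n
      + (h$2 * (r * q) + h$3 * (r * q * \<tau> * v)) *\<^sub>R m
      + (h$3 * rho S rc R r \<theta> t) *\<^sub>R e1 t)) (coord_filter S \<xi>)"
proof -
  let ?F = "coord_filter S \<xi>"
  have nth: "((\<lambda>\<eta>. \<eta>$i) has_derivative (\<lambda>h. h$i)) ?F" for i
    by (intro bounded_linear_imp_has_derivative bounded_linear_vec_nth)
  have \<xi>: "\<xi>$1 = r" "\<xi>$2 = \<theta>" "\<xi>$3 = t"
    by (simp_all add: \<xi>_def)
  \<comment> \<open>Chain rule relative to sets: the third coordinate maps the domain of the filter
    into \<open>S\<close>, so derivatives within \<open>S\<close> suffice, also at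
    endpoints.\<close>
  have along: "((\<lambda>\<eta>. f (\<eta>$3)) has_derivative (\<lambda>h. h$3 *\<^sub>R f')) ?F"
    if "(f has_vector_derivative f') (at t within S)" for f :: "real \<Rightarrow> real^3" and f'
  proof (rule has_derivative_in_compose[OF nth])
    show "(f has_derivative (\<lambda>x. x *\<^sub>R f')) (at (\<xi>$3) within (\<lambda>\<eta>. \<eta>$3) ` {\<eta>. \<eta>$3 \<in> S})"
      using that unfolding has_vector_derivative_def \<xi> by (rule has_derivative_subset) auto
  qed
  have "((\<lambda>\<eta>. (\<eta>$2, \<eta>$3)) has_derivative (\<lambda>h. (h$2, h$3))) ?F"
    by (intro has_derivative_Pair nth)
  moreover have "((\<lambda>(s, w). R s w) has_derivative (\<lambda>(h, k). h * p + k * d))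
      (at (\<xi>$2, \<xi>$3) within (\<lambda>\<eta>. (\<eta>$2, \<eta>$3)) ` {\<eta>. \<eta>$3 \<in> S})"
    using R unfolding \<xi> by (rule has_derivative_subset) auto
  ultimately have dR: "((\<lambda>\<eta>. R (\<eta>$2) (\<eta>$3)) has_derivative (\<lambda>h. h$2 * p + h$3 * d)) ?F"
    using has_derivative_in_compose by fastforce
  \<comment> \<open>The terms stand in the order in which the product rules generate them; they are
    regrouped along \<open>n\<close>, \<open>m\<close> and \<open>e1\<close> only at the
    end.\<close>
  have "((\<lambda>\<eta>. rc (\<eta>$3) + (\<eta>$1 * R (\<eta>$2) (\<eta>$3) * cos (\<eta>$2)) *\<^sub>R e2 (\<eta>$3)
             + (\<eta>$1 * R (\<eta>$2) (\<eta>$3) * sin (\<eta>$2)) *\<^sub>R e3 (\<eta>$3)) has_derivative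
     (\<lambda>h. h$3 *\<^sub>R (v *\<^sub>R e1 t)
       + ((r * q * cos \<theta>) *\<^sub>R (h$3 *\<^sub>R ((\<tau> * v) *\<^sub>R e3 t - (\<kappa> * v) *\<^sub>R e1 t))
         + (r * q * (- sin \<theta> * h$2) + (r * (h$2 * p + h$3 * d) + h$1 * q) * cos \<theta>) *\<^sub>R e2 t)
       + ((r * q * sin \<theta>) *\<^sub>R (h$3 *\<^sub>R ((- \<tau> * v) *\<^sub>R e2 t))
         + (r * q * (cos \<theta> * h$2) + (r * (h$2 * p + h$3 * d) + h$1 * q) * sin \<theta>) *\<^sub>R e3 t))) ?F"
    by (rule has_derivative_eq_rhs, (rule derivative_intros nth dR along[OF curve_deriv_frame]
          along[OF frame2_deriv] along[OF frame3_deriv])+)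
      (simp add: \<xi> q_def fun_eq_iff mult_ac)
  then have "(coord_map S rc R has_derivative
     (\<lambda>h. h$3 *\<^sub>R (v *\<^sub>R e1 t)
       + ((r * q * cos \<theta>) *\<^sub>R (h$3 *\<^sub>R ((\<tau> * v) *\<^sub>R e3 t - (\<kappa> * v) *\<^sub>R e1 t))
         + (r * q * (- sin \<theta> * h$2) + (r * (h$2 * p + h$3 * d) + h$1 * q) * cos \<theta>) *\<^sub>R e2 t)
       + ((r * q * sin \<theta>) *\<^sub>R (h$3 *\<^sub>R ((- \<tau> * v) *\<^sub>R e2 t))
         + (r * q * (cos \<theta> * h$2) + (r * (h$2 * p + h$3 * d) + h$1 * q) * sin \<theta>) *\<^sub>R e3 t))) ?F"
    by (simp add: coord_map_def[abs_def] Let_def)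
  then show ?thesis
    by (rule has_derivative_eq_rhs) (simp add: fun_eq_iff n_def m_def rho_def q_def algebra_simps)
qed

end

section \<open>Identifying the Jacobi matrix and the partial derivatives\<close>

text \<open>A derivative within a set is unique if the set contains points arbitrarily close to
  \<xi> along every axis. The first two coordinates are unrestricted; along the third, such points
  exist because \<open>\<xi>$3\<close> is a limit point of \<open>S\<close>.\<close>

lemma jacobian_coord_filter_eqI:
  fixes f :: "real^3 \<Rightarrow> real^'m"
  assumes mem: "\<xi>$3 \<in> S" and lim: "\<xi>$3 islimpt S"
    and f: "(f has_derivative (\<lambda>h. A *v h)) (coord_filter S \<xi>)"
  shows "jacobian f (coord_filter S \<xi>) = A"
proof -
  have "(f has_derivative (\<lambda>h. jacobian f (coord_filter S \<xi>) *v h)) (coord_filter S \<xi>)"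
    using f jacobian_works differentiableI by blast
  then have "(\<lambda>h. jacobian f (coord_filter S \<xi>) *v h) = (\<lambda>h. A *v h)"
    using f
  proof (rule frechet_derivative_unique_within)
    fix i :: "real^3" and e :: real
    assume "i \<in> Basis" "e > 0"
    then obtain k where k: "i = axis k 1" by (auto simp: Basis_vec_def)
    show "\<exists>d. 0 < \<bar>d\<bar> \<and> \<bar>d\<bar> < e \<and> \<xi> + d *\<^sub>R i \<in> {\<eta>. \<eta>$3 \<in> S}"
    proof (cases "k = 3")
      case True
      obtain w where "w \<in> S" "w \<noteq> \<xi>$3" "dist w (\<xi>$3) < e"
        using lim \<open>e > 0\<close> unfolding islimpt_approachable by blast
      then show ?thesis
        using True k by (intro exI[of _ "w - \<xi>$3"]) (auto simp: axis_def dist_real_def)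
    next
      case False
      then show ?thesis
        using k mem \<open>e > 0\<close> by (intro exI[of _ "e / 2"]) (auto simp: axis_def)
    qed
  qed
  then show ?thesis
    by (metis matrix_eq)
qed

text \<open>Smoothness provides some total derivative \<open>D\<close>. Restricting it to the two
  coordinate slices through the point identifies its values on the unit vectors with the partial
  derivatives, and linearity gives the rest.\<close>

lemma C1_section_has_derivative:
  assumes R: "C1_section S R" and w: "w \<in> S" "w islimpt S"
  shows "((\<lambda>(s, w). R s w) has_derivative (\<lambda>(h, k). h * d_theta R \<theta> w + k * d_omega S R \<theta> w))
    (at (\<theta>, w) within Sigma UNIV (\<lambda>_. S))"
proof -
  let ?T = "Sigma UNIV (\<lambda>_. S) :: (real \<times> real) set" and ?f = "\<lambda>(s, w). R s w"
  obtain D where D: "(?f has_derivative D) (at (\<theta>, w) within ?T)"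
    using R w by (auto simp: C1_section_def differentiable_def)
  interpret D: bounded_linear D
    using D by (rule has_derivative_bounded_linear)
  have "((\<lambda>s. ?f (s, w)) has_derivative (\<lambda>h. D (h, 0))) (at \<theta>)"
  proof (rule has_derivative_in_compose[where f = "\<lambda>s. (s, w)"])
    show "(?f has_derivative D) (at (\<theta>, w) within range (\<lambda>s. (s, w)))"
      using D by (rule has_derivative_subset) (use w in auto)
  qed (intro derivative_intros)
  moreover have "(\<lambda>h. D (h, 0)) = (\<lambda>h. D (1, 0) * h)"
  proof
    show "D (h, 0) = D (1, 0) * h" for h
      using D.scaleR[of h "(1, 0)"] by (simp add: mult.commute)
  qed
  ultimately have "((\<lambda>s. R s w) has_field_derivative D (1, 0)) (at \<theta>)"
    unfolding has_field_derivative_def by simp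
  then have 1: "d_theta R \<theta> w = D (1, 0)"
    by (simp add: d_theta_def DERIV_imp_deriv)
  have "((\<lambda>x. ?f (\<theta>, x)) has_derivative (\<lambda>h. D (0, h))) (at w within S)"
  proof (rule has_derivative_in_compose[where f = "\<lambda>x. (\<theta>, x)"])
    show "(?f has_derivative D) (at (\<theta>, w) within (\<lambda>x. (\<theta>, x)) ` S)"
      using D by (rule has_derivative_subset) auto
  qed (intro derivative_intros)
  moreover have "(\<lambda>h. D (0, h)) = (\<lambda>h. h *\<^sub>R D (0, 1))"
  proof
    show "D (0, h) = h *\<^sub>R D (0, 1)" for h
      using D.scaleR[of h "(0, 1)"] by simp
  qed
  ultimately have "((\<lambda>x. R \<theta> x) has_vector_derivative D (0, 1)) (at w within S)"
    unfolding has_vector_derivative_def by simp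
  \<comment> \<open>The limit point condition makes the filter nontrivial, so the vector derivative
    within \<open>S\<close> is unique.\<close>
  then have 2: "d_omega S R \<theta> w = D (0, 1)"
    using w by (simp add: d_omega_def deriv_on_def vector_derivative_within trivial_limit_within)
  have "D x = (case x of (h, k) \<Rightarrow> h * d_theta R \<theta> w + k * d_omega S R \<theta> w)" for x
  proof (cases x)
    case (Pair h k)
    then show ?thesis
      using D.add[of "(h, 0)" "(0, k)"] D.scaleR[of h "(1, 0)"] D.scaleR[of k "(0, 1)"]
      by (simp add: 1 2)
  qed
  with D show ?thesis by (metis (no_types, lifting) ext)
qed

section \<open>Linear algebra of the metric tensor\<close>

text \<open>The product is the Gram matrix of the rows of \<open>P\<close>. The determinant is the
  triple product of the rows, which equals the squared norm of n x m.\<close>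

lemma rotation_frame:
  fixes n m :: "real^3"
  assumes "n \<bullet> n = 1" "m \<bullet> m = 1" "n \<bullet> m = 0"
  defines "P \<equiv> vector [n, m, n \<times> m] :: real^3^3"
  shows "P ** transpose P = mat 1" "det P = 1"
proof -
  have *: "(n \<times> m) \<bullet> (n \<times> m) = 1"
    using norm_cross_dot[of n m] assms by (simp add: power2_norm_eq_inner power_mult_distrib)
  have gram: "P ** transpose P = (\<chi> i j. P$i \<bullet> P$j)"
    by (simp add: matrix_matrix_mult_def transpose_def inner_vec_def)
  show "P ** transpose P = mat 1"
    using * assms(1-3) unfolding gram vec_eq_iff forall_3
    by (simp add: P_def mat_def inner_commute dot_cross_self)
  show "det P = 1"
    using * cross_triple[of n m "n \<times> m"] unfolding P_def dot_cross_det[symmetric]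
    by (simp add: inner_commute)
qed

text \<open>The orthogonal factor cancels in the metric, leaving \<open>transpose U ** U\<close>,
  whose inverse is the product of the inverses in reverse order.\<close>

lemma metric_inverse_triangular:
  fixes J P U W :: "real^3^3"
  assumes P: "P ** transpose P = mat 1" and J: "J = transpose P ** U" and W: "U ** W = mat 1"
  shows "invertible (transpose J ** J)" "matrix_inv (transpose J ** J) = W ** transpose W"
proof -
  have "transpose J ** J = transpose U ** (P ** transpose P) ** U"
    by (simp add: J matrix_transpose_mul matrix_mul_assoc)
  then have G: "transpose J ** J = transpose U ** U"
    by (simp add: P)
  have "W ** U = mat 1"
    using W matrix_left_right_inverse by blast
  then have "transpose U ** transpose W = mat 1"
    by (metis matrix_transpose_mul transpose_mat)
  moreover have "(transpose U ** U) ** (W ** transpose W) = transpose U ** (U ** W) ** transpose W"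
    by (simp add: matrix_mul_assoc)
  ultimately have "(transpose J ** J) ** (W ** transpose W) = mat 1"
    by (simp add: G W)
  then show "invertible (transpose J ** J)" "matrix_inv (transpose J ** J) = W ** transpose W"
    by (auto simp: invertible_right_inverse intro: matrix_inv_unique)
qed

section \<open>Jacobian, contravariant metric and positivity\<close>

text \<open>The closure of \<open>I\<close> may be unbounded, so the maximum in the last condition
  is expressed by a point \<open>w\<^sub>m\<close> at which it is attained. Points of
  \<open>I\<close> on its boundary are covered through one-sided derivatives.\<close>

theorem theorem1:
  fixes I :: "real set" and rc :: "real \<Rightarrow> real^3" and R :: "real \<Rightarrow> real \<Rightarrow> real"
    and r \<theta> \<omega> :: real
  assumes interval: "is_interval I" "interior I \<noteq> {}"
    and curve_smooth: "C_k_on 3 (closure I) rc"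
    and curve_regular: "\<And>w. w \<in> closure I \<Longrightarrow> deriv_on (closure I) rc w \<noteq> 0"
    and curve_curved: "\<And>w. w \<in> closure I \<Longrightarrow> curvature (closure I) rc w \<noteq> 0"
    and section_smooth: "C1_section (closure I) R"
    and section_pos: "\<And>t w. w \<in> closure I \<Longrightarrow> R t w > 0"
    and section_periodic: "\<And>t w. w \<in> closure I \<Longrightarrow> R (t + 2 * pi) w = R t w"
    and r: "r \<in> {0<..<1}" and theta: "\<theta> \<in> {0..<2 * pi}" and omega: "\<omega> \<in> I"
  shows
    "let S = closure I;
         \<xi> = vector [r, \<theta>, \<omega>];
         JJ = det (jacobi_matrix S rc R \<xi>);
         G = covariant_metric S rc R \<xi>;
         g = contravariant_metric S rc R \<xi>;
         \<kappa> = curvature S rc \<omega>; \<tau> = torsion S rc \<omega>; v = speed S rc \<omega>;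
         q = R \<theta> \<omega>; q\<^sub>\<theta> = d_theta R \<theta> \<omega>;
         Rt = R_tilde R \<theta> \<omega>; Rh = R_hat S rc R \<theta> \<omega>; \<rho> = rho S rc R r \<theta> \<omega>
     in
       coord_map S rc R differentiable (coord_filter S \<xi>) \<and>
       JJ = r * q^2 * v * (1 - r * \<kappa> * q * cos \<theta>) \<and>
       JJ = r * q^2 * \<rho> \<and>
       (JJ > 0 \<longrightarrow>
          invertible G \<and>
          transpose g = g \<and>
          g$1$1 = Rt / q^4 + r^2 * Rh^2 / (\<rho>^2 * q^2) \<and>
          g$2$2 = 1 / (r^2 * q^2) + \<tau>^2 * v^2 / \<rho>^2 \<and>
          g$3$3 = 1 / \<rho>^2 \<and>
          g$1$2 = - (q\<^sub>\<theta> / (r * q^3)) + r * \<tau> * v * Rh / (\<rho>^2 * q) \<and>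
          g$1$3 = - (r * Rh / (\<rho>^2 * q)) \<and>
          g$2$3 = - (\<tau> * v / \<rho>^2)) \<and>
       (\<theta> \<in> {pi / 2..3 * pi / 2} \<longrightarrow> JJ > 0) \<and>
       (\<theta> \<in> {0..<pi / 2} \<union> {3 * pi / 2<..<2 * pi} \<longrightarrow>
        (\<exists>w\<^sub>m. is_arg_max (R \<theta>) (\<lambda>w. w \<in> S) w\<^sub>m \<and>
              (\<forall>w\<in>S. R \<theta> w\<^sub>m < inverse (curvature S rc w) * inverse (cos \<theta>))) \<longrightarrow>
        JJ > 0)"
proof -
  define S where "S = closure I"
  define \<xi> :: "real^3" where "\<xi> = vector [r, \<theta>, \<omega>]"
  define \<kappa> \<tau> v where "\<kappa> = curvature S rc \<omega>" and "\<tau> = torsion S rc \<omega>" and "v = speed S rc \<omega>"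
  define q p d where "q = R \<theta> \<omega>" and "p = d_theta R \<theta> \<omega>" and "d = d_omega S R \<theta> \<omega>"
  define \<rho> where "\<rho> = rho S rc R r \<theta> \<omega>"
  define n m where "n = cos \<theta> *\<^sub>R frame2 S rc \<omega> + sin \<theta> *\<^sub>R frame3 S rc \<omega>"
    and "m = cos \<theta> *\<^sub>R frame3 S rc \<omega> - sin \<theta> *\<^sub>R frame2 S rc \<omega>"
  define J where "J = jacobi_matrix S rc R \<xi>"
  define P where "P = (vector [n, m, n \<times> m] :: real^3^3)"
  define U where "U = (vector [vector [q, r * p, r * d], vector [0, r * q, r * q * \<tau> * v],
    vector [0, 0, \<rho>]] :: real^3^3)"
  have \<omega>: "\<omega> \<in> S" using omega closure_subset unfolding S_def by blast
  \<comment> \<open>A connected set with more than one point has no isolated points. This secures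
    uniqueness of all derivatives within \<open>S\<close>.\<close>
  have lim: "\<omega> islimpt S"
  proof (rule connected_imp_perfect[OF _ \<omega>])
    show "connected S"
      unfolding S_def using interval(1) by (simp add: is_interval_connected_1 connected_imp_connected_closure)
    show "S \<noteq> {x}" for x
      using interval(2) interior_mono[OF closure_subset[of I]] unfolding S_def by (metis interior_singleton subset_empty)
  qed
  note curve = curve_smooth[folded S_def] \<omega> curve_regular[folded S_def, OF \<omega>] curve_curved[folded S_def, OF \<omega>]
  note on = frame_orthonormal[OF curve]
  have v: "v > 0" and \<kappa>: "\<kappa> > 0"
    unfolding v_def \<kappa>_def using speed_pos[OF curve] curvature_pos[OF curve] .
  have q: "q > 0" using section_pos \<omega> by (simp add: q_def S_def)
  have r0: "0 < r" "r < 1" using r by auto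
  have \<rho>: "\<rho> = v * (1 - r * \<kappa> * q * cos \<theta>)"
    by (simp add: \<rho>_def rho_def v_def \<kappa>_def q_def)
  have nm: "n \<bullet> n = 1" "m \<bullet> m = 1" "n \<bullet> m = 0"
    using on by (simp_all add: n_def m_def inner_simps inner_commute power2_eq_square[symmetric])
  have "n \<times> m = ((cos \<theta>)\<^sup>2 + (sin \<theta>)\<^sup>2) *\<^sub>R (frame2 S rc \<omega> \<times> frame3 S rc \<omega>)"
    unfolding scaleR_add_left power2_eq_square n_def m_def
    by (simp add: cross_add_left cross_add_right Cross3.left_diff_distrib Cross3.right_diff_distrib
        cross_mult_left cross_mult_right cross_skew[of "frame3 S rc \<omega>" "frame2 S rc \<omega>"] scaleR_add_right)
  then have e1: "frame1 S rc \<omega> = n \<times> m"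
    using on by simp
  note P = rotation_frame[OF nm, folded P_def]
  \<comment> \<open>The rows of \<open>P\<close> are the basis vectors, so
    \<open>transpose P\<close> turns coordinates in the moving basis into standard ones.\<close>
  have "((\<lambda>h. (h$1 * q + h$2 * (r * p) + h$3 * (r * d)) *\<^sub>R n
      + (h$2 * (r * q) + h$3 * (r * q * \<tau> * v)) *\<^sub>R m + (h$3 * \<rho>) *\<^sub>R (n \<times> m)))
    = (\<lambda>h. (transpose P ** U) *v h)"
    by (simp add: fun_eq_iff P_def U_def vec_eq_iff matrix_vector_mult_def matrix_matrix_mult_def
        transpose_def sum_3 algebra_simps)
  then have D: "(coord_map S rc R has_derivative (\<lambda>h. (transpose P ** U) *v h)) (coord_filter S \<xi>)"
    using coord_map_has_derivative[OF curve C1_section_has_derivative[OF section_smooth[folded S_def] \<omega> lim],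
        of \<theta> r, folded \<xi>_def q_def p_def d_def n_def m_def \<tau>_def v_def \<rho>_def e1]
    by (simp add: e1)
  have J: "J = transpose P ** U"
    unfolding J_def jacobi_matrix_def
    by (rule jacobian_coord_filter_eqI[OF _ _ D]) (simp_all add: \<xi>_def \<omega> lim)
  have det: "det J = r * q^2 * \<rho>"
  proof -
    have "det U = r * q^2 * \<rho>"
      by (simp add: U_def det_3 power2_eq_square)
    then show ?thesis
      using P(2) by (simp add: J det_mul det_transpose)
  qed
  have pos: "det J > 0" if "r * \<kappa> * q * cos \<theta> < 1"
    using that v q r0 by (simp add: det \<rho>)
  have inv: "invertible (covariant_metric S rc R \<xi>) \<and>
          transpose (contravariant_metric S rc R \<xi>) = contravariant_metric S rc R \<xi> \<and>
          contravariant_metric S rc R \<xi>$1$1 =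
            R_tilde R \<theta> \<omega> / q^4 + r^2 * (R_hat S rc R \<theta> \<omega>)^2 / (\<rho>^2 * q^2) \<and>
          contravariant_metric S rc R \<xi>$2$2 = 1 / (r^2 * q^2) + \<tau>^2 * v^2 / \<rho>^2 \<and>
          contravariant_metric S rc R \<xi>$3$3 = 1 / \<rho>^2 \<and>
          contravariant_metric S rc R \<xi>$1$2 =
            - (p / (r * q^3)) + r * \<tau> * v * R_hat S rc R \<theta> \<omega> / (\<rho>^2 * q) \<and>
          contravariant_metric S rc R \<xi>$1$3 = - (r * R_hat S rc R \<theta> \<omega> / (\<rho>^2 * q)) \<and>
          contravariant_metric S rc R \<xi>$2$3 = - (\<tau> * v / \<rho>^2)" if "det J > 0"
  proof -
    have \<rho>0: "\<rho> \<noteq> 0" using that det by auto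
    \<comment> \<open>Back substitution in \<open>U\<close>. Eliminating \<open>r * p\<close> above
      the second pivot from the last column is what creates \<open>R_hat\<close>, the combination d
      - \<tau> v p.\<close>
    define W where "W = (vector [vector [1 / q, - p / q^2, - (r * (d - \<tau> * v * p) / (q * \<rho>))],
      vector [0, 1 / (r * q), - (\<tau> * v / \<rho>)], vector [0, 0, 1 / \<rho>]] :: real^3^3)"
    have "U ** W = mat 1"
      using q r0 \<rho>0 by (simp add: U_def W_def matrix_matrix_mult_def vec_eq_iff forall_3 sum_3 mat_def)
        (simp add: field_simps power2_eq_square)
    from metric_inverse_triangular[OF P(1) J this]
    have G: "invertible (covariant_metric S rc R \<xi>)"
      "contravariant_metric S rc R \<xi> = W ** transpose W"
      by (simp_all add: covariant_metric_def contravariant_metric_def J_def)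
    have Rs: "R_tilde R \<theta> \<omega> = q^2 + p^2" "R_hat S rc R \<theta> \<omega> = d - \<tau> * v * p"
      by (simp_all add: R_tilde_def R_hat_def q_def p_def d_def \<tau>_def v_def)
    \<comment> \<open>Each metric component is an inner product of two rows of \<open>W\<close>. In
      the (1,1) entry the first two squares combine to \<open>R_tilde\<close> over
      \<open>q^4\<close>.\<close>
    have entry: "(W ** transpose W)$i$j = (\<Sum>k\<in>UNIV. W$i$k * W$j$k)" for i j
      by (simp add: matrix_matrix_mult_def transpose_def)
    show ?thesis
      using q r0 \<rho>0 unfolding G(2) entry Rs
      by (simp add: G(1) matrix_transpose_mul)
        (simp add: W_def sum_3 power_divide power_mult_distrib field_simps power2_eq_square
          power3_eq_cube power4_eq_xxxx)
  qed
  have cos_nonpos: "det J > 0" if "\<theta> \<in> {pi / 2..3 * pi / 2}"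
  proof (rule pos)
    \<comment> \<open>Shifting by \<open>pi\<close> moves the range to the interval around 0 where
      cosine is nonnegative.\<close>
    have "cos (\<theta> - pi) \<ge> 0" using that by (intro cos_ge_zero) auto
    then have "cos \<theta> \<le> 0" by simp
    then have "r * \<kappa> * q * cos \<theta> \<le> 0"
      using r0 q \<kappa> by (intro mult_nonneg_nonpos) auto
    then show "r * \<kappa> * q * cos \<theta> < 1" by simp
  qed
  have cos_pos: "det J > 0" if th: "\<theta> \<in> {0..<pi / 2} \<union> {3 * pi / 2<..<2 * pi}"
    and "\<exists>w\<^sub>m. is_arg_max (R \<theta>) (\<lambda>w. w \<in> S) w\<^sub>m \<and>
              (\<forall>w\<in>S. R \<theta> w\<^sub>m < inverse (curvature S rc w) * inverse (cos \<theta>))"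
  proof (rule pos)
    have "cos \<theta> > 0"
    proof (cases "\<theta> < pi / 2")
      case True then show ?thesis using theta by (intro cos_gt_zero_pi) auto
    next
      case False
      then have "cos (\<theta> - 2 * pi) > 0" using th by (intro cos_gt_zero_pi) auto
      then show ?thesis by (simp add: cos_diff)
    qed
    \<comment> \<open>The maximum dominates the value at \<omega>, and the assumed bound is taken at
      w = \<omega> as well.\<close>
    have "q < inverse \<kappa> * inverse (cos \<theta>)"
      using that(2) \<omega> unfolding is_arg_max_def q_def \<kappa>_def by (meson leI le_less_trans)
    then have "\<kappa> * q * cos \<theta> < 1"
      using \<kappa> \<open>cos \<theta> > 0\<close> by (simp add: field_simps)
    \<comment> \<open>The factor multiplying \<open>r\<close> is positive, so r < 1 preserves the
      bound.\<close>
    moreover have "r * (\<kappa> * q * cos \<theta>) \<le> 1 * (\<kappa> * q * cos \<theta>)"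
      using r0 q \<kappa> \<open>cos \<theta> > 0\<close> by (intro mult_right_mono) auto
    ultimately show "r * \<kappa> * q * cos \<theta> < 1"
      by (simp add: mult.assoc)
  qed
  have diff: "coord_map S rc R differentiable (coord_filter S \<xi>)"
    using D by (rule differentiableI)
  have det': "det J = r * q^2 * v * (1 - r * \<kappa> * q * cos \<theta>)"
    by (simp add: det \<rho>)
  show ?thesis
    unfolding Let_def S_def[symmetric] \<xi>_def[symmetric] J_def[symmetric] q_def[symmetric] p_def[symmetric]
      \<kappa>_def[symmetric] \<tau>_def[symmetric] v_def[symmetric] \<rho>_def[symmetric]
    using diff det det' inv cos_nonpos cos_pos by blast
qed

end
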